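(* Let $(\mathcal{T}_n)_{n\ge1}$ be a sequence of size-conditioned simply generated trees of type I, II or III. Then the family of random variables $\{\partial(\mathcal{T}_n)\}_{n\ge1}$ is uniformly integrable of every order; that is, for every real $p\ge0$ the family $\{\partial(\mathcal{T}_n)^p\}_n$, with $n$ ranging over all $n\ge1$ for which $\mathcal{T}_n$ is defined, is uniformly integrable.
   Context: **Simply generated trees.** A weight sequence is a sequence $\mathbf w=(\omega_k)_{k\ge0}$ of non-negative reals with $\omega_0>0$ and $\omega_k>0$ for at least one $k\ge2$. For $n\ge 1$, $\mathcal{T}_n$ is the random rooted plane tree with $n$ vertices such that $\mathbf P(\mathcal{T}_n=T)$ is proportional to $\prod_{v\in T}\omega_{d_T^+(v)}$ for each $n$-vertex rooted plane tree $T$, where $d_T^+(v)$ is the outdegree (number of children) of $v$. Throughout, only those $n$ are considered for which some $n$-vertex tree has positive weight ("$\mathcal{T}_n$ is defined"). **Types.** Let $\Phi(z)=\sum_{k\ge0}\omega_kz^k$ with radius of convergence $R\in[0,\infty]$. Type I: there is a (finite) $\tau\in(0,R]$ with $\Phi(\tau)<\infty$ and $\tau\Phi'(\tau)/\Phi(\tau)=1$. Type II: $R>0$, $\Phi(R)<\infty$ and $R\Phi'(R)/\Phi(R)<1$. Type III: $R=0$. **Distance to the border.** A leaf is a vertex with no children. For a rooted tree $T$, $\partial(T)$ is the minimal graph distance from the root to a leaf of $T$. *)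

theory Defs
  imports "HOL-Probability.Probability"
begin

section \<open>Rooted plane trees\<close>

datatype ptree = Node (children: "ptree list")

text \<open>
  Vertices are addressed as in the Ulam--Harris encoding: \<^term>\<open>[]\<close> is the root, and
  \<^term>\<open>v @ [i]\<close> is the child of \<^term>\<open>v\<close> with index \<^term>\<open>i\<close>, counted from 0.
\<close>

fun subtree_at :: "ptree \<Rightarrow> nat list \<Rightarrow> ptree option" where
  "subtree_at T [] = Some T"
| "subtree_at T (i # v) =
    (if i < length (children T) then subtree_at (children T ! i) v else None)"

definition vertices :: "ptree \<Rightarrow> nat list set" where
  "vertices T = {v. subtree_at T v \<noteq> None}"

definition outdegree :: "ptree \<Rightarrow> nat list \<Rightarrow> nat" where
  "outdegree T v = length (children (the (subtree_at T v)))"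

definition leaves :: "ptree \<Rightarrow> nat list set" where
  "leaves T = {v \<in> vertices T. outdegree T v = 0}"

definition adjacent :: "ptree \<Rightarrow> (nat list \<times> nat list) set" where
  "adjacent T = {(u, v). u \<in> vertices T \<and> v \<in> vertices T \<and> (\<exists>i. v = u @ [i] \<or> u = v @ [i])}"

definition graph_dist :: "ptree \<Rightarrow> nat list \<Rightarrow> nat list \<Rightarrow> nat" where
  "graph_dist T u v = (LEAST d. (u, v) \<in> adjacent T ^^ d)"

definition border_dist :: "ptree \<Rightarrow> nat" where
  "border_dist T = Min (graph_dist T [] ` leaves T)"


section \<open>Weight sequences and their types\<close>

definition weight_sequence :: "(nat \<Rightarrow> real) \<Rightarrow> bool" where
  "weight_sequence w \<longleftrightarrow> (\<forall>k. 0 \<le> w k) \<and> 0 < w 0 \<and> (\<exists>k\<ge>2. 0 < w k)"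

definition gen_fun :: "(nat \<Rightarrow> real) \<Rightarrow> real \<Rightarrow> real" where
  "gen_fun w z = (\<Sum>k. w k * z ^ k)"

definition gen_fun_deriv :: "(nat \<Rightarrow> real) \<Rightarrow> real \<Rightarrow> real" where
  "gen_fun_deriv w z = (\<Sum>k. real k * w k * z ^ (k - 1))"

text \<open>
  On the boundary of the disc of convergence the series of \<open>\<Phi>\<close> or of \<open>\<Phi>'\<close> may diverge to
  \<open>\<infinity>\<close>, while \<^const>\<open>suminf\<close> of a divergent series is an unspecified real. Hence both
  summability conditions below: the first says \<open>\<Phi> < \<infinity>\<close>, and the second says \<open>\<Phi>' < \<infinity>\<close>, which
  is implicit in the ratio being equal to (less than) 1.
\<close>

definition type_I :: "(nat \<Rightarrow> real) \<Rightarrow> bool" where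
  "type_I w \<longleftrightarrow>
    (\<exists>\<tau>::real. 0 < \<tau> \<and> ereal \<tau> \<le> conv_radius w \<and>
      summable (\<lambda>k. w k * \<tau> ^ k) \<and> summable (\<lambda>k. real k * w k * \<tau> ^ (k - 1)) \<and>
      \<tau> * gen_fun_deriv w \<tau> / gen_fun w \<tau> = 1)"

text \<open>
  In type II the radius is necessarily finite: for a weight sequence with infinite radius of
  convergence, \<open>\<Phi>(z) \<rightarrow> \<infinity>\<close> as \<open>z \<rightarrow> \<infinity>\<close>.
\<close>

definition type_II :: "(nat \<Rightarrow> real) \<Rightarrow> bool" where
  "type_II w \<longleftrightarrow>
    (\<exists>R::real. 0 < R \<and> conv_radius w = ereal R \<and>
      summable (\<lambda>k. w k * R ^ k) \<and> summable (\<lambda>k. real k * w k * R ^ (k - 1)) \<and>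
      R * gen_fun_deriv w R / gen_fun w R < 1)"

definition type_III :: "(nat \<Rightarrow> real) \<Rightarrow> bool" where
  "type_III w \<longleftrightarrow> conv_radius w = 0"


section \<open>Simply generated trees\<close>

definition ptrees :: "nat \<Rightarrow> ptree set" where
  "ptrees n = {T. card (vertices T) = n}"

definition tree_weight :: "(nat \<Rightarrow> real) \<Rightarrow> ptree \<Rightarrow> real" where
  "tree_weight w T = (\<Prod>v\<in>vertices T. w (outdegree T v))"

definition sg_defined :: "(nat \<Rightarrow> real) \<Rightarrow> nat \<Rightarrow> bool" where
  "sg_defined w n \<longleftrightarrow> (\<exists>T\<in>ptrees n. 0 < tree_weight w T)"

text \<open>
  The law of the size-conditioned tree. It is meaningful only under \<^const>\<open>sg_defined\<close>; see
  \<open>pmf_sg_tree\<close> below.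
\<close>

definition sg_tree :: "(nat \<Rightarrow> real) \<Rightarrow> nat \<Rightarrow> ptree pmf" where
  "sg_tree w n = embed_pmf (\<lambda>T. if T \<in> ptrees n
     then tree_weight w T / (\<Sum>S\<in>ptrees n. tree_weight w S) else 0)"

lemma vertices_Node:
  "vertices (Node ts) = insert [] (\<Union>i<length ts. (#) i ` vertices (ts ! i))"
proof (rule set_eqI)
  fix v
  show "v \<in> vertices (Node ts) \<longleftrightarrow> v \<in> insert [] (\<Union>i<length ts. (#) i ` vertices (ts ! i))"
    by (cases v) (auto simp: vertices_def)
qed

lemma finite_vertices: "finite (vertices T)"
  by (induction T) (auto simp: vertices_Node)

lemma card_vertices_Node:
  "card (vertices (Node ts)) = Suc (\<Sum>i<length ts. card (vertices (ts ! i)))"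
proof -
  have "card (\<Union>i<length ts. (#) i ` vertices (ts ! i)) =
      (\<Sum>i<length ts. card ((#) i ` vertices (ts ! i)))"
    by (rule card_UN_disjoint) (auto simp: finite_vertices)
  also have "\<dots> = (\<Sum>i<length ts. card (vertices (ts ! i)))"
    by (simp add: card_image)
  finally have eq: "card (\<Union>i<length ts. (#) i ` vertices (ts ! i)) =
      (\<Sum>i<length ts. card (vertices (ts ! i)))" .
  have "[] \<notin> (\<Union>i<length ts. (#) i ` vertices (ts ! i))" by auto
  moreover have "finite (\<Union>i<length ts. (#) i ` vertices (ts ! i))"
    by (auto simp: finite_vertices)
  ultimately show ?thesis unfolding vertices_Node by (simp add: eq)
qed

lemma card_vertices_pos: "0 < card (vertices T)"
  by (cases T) (simp add: card_vertices_Node)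

lemma finite_ptrees: "finite (ptrees n)"
proof (induction n rule: less_induct)
  case (less n)
  let ?A = "\<Union>m<n. ptrees m"
  have "ptrees n \<subseteq> Node ` {ts. set ts \<subseteq> ?A \<and> length ts \<le> n}"
  proof
    fix T assume T: "T \<in> ptrees n"
    obtain ts where ts: "T = Node ts" by (cases T)
    have n: "n = Suc (\<Sum>i<length ts. card (vertices (ts ! i)))"
      using T by (simp add: ptrees_def ts card_vertices_Node)
    have "length ts = (\<Sum>i<length ts. 1)" by simp
    also have "\<dots> \<le> (\<Sum>i<length ts. card (vertices (ts ! i)))"
      by (rule sum_mono) (use card_vertices_pos in \<open>auto simp: Suc_le_eq\<close>)
    finally have "length ts \<le> n" using n by simp
    moreover have "set ts \<subseteq> ?A"
    proof
      fix S assume "S \<in> set ts"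
      then obtain i where i: "i < length ts" "S = ts ! i" by (auto simp: in_set_conv_nth)
      have "card (vertices S) \<le> (\<Sum>i<length ts. card (vertices (ts ! i)))"
        unfolding i(2) by (rule member_le_sum) (use i in auto)
      then show "S \<in> ?A" using n by (auto simp: ptrees_def)
    qed
    ultimately show "T \<in> Node ` {ts. set ts \<subseteq> ?A \<and> length ts \<le> n}" using ts by auto
  qed
  moreover have "finite (Node ` {ts. set ts \<subseteq> ?A \<and> length ts \<le> n})"
    using less by (intro finite_imageI finite_lists_length_le) auto
  ultimately show ?case by (rule finite_subset)
qed

lemma pmf_sg_tree:
  assumes "weight_sequence w" and "sg_defined w n"
  shows "pmf (sg_tree w n) T = (if T \<in> ptrees n
     then tree_weight w T / (\<Sum>S\<in>ptrees n. tree_weight w S) else 0)"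
proof -
  let ?Z = "\<Sum>S\<in>ptrees n. tree_weight w S"
  have nonneg: "0 \<le> tree_weight w S" for S
    using assms(1) by (auto simp: tree_weight_def weight_sequence_def intro!: prod_nonneg)
  obtain S where S: "S \<in> ptrees n" "0 < tree_weight w S"
    using assms(2) by (auto simp: sg_defined_def)
  have Z: "0 < ?Z"
    using S nonneg by (intro sum_pos2[of _ S]) (auto simp: finite_ptrees)
  show ?thesis
    unfolding sg_tree_def
  proof (rule pmf_embed_pmf)
    show "0 \<le> (if x \<in> ptrees n then tree_weight w x / ?Z else 0)" for x
      using nonneg Z by simp
    have "(\<integral>\<^sup>+x. ennreal (if x \<in> ptrees n then tree_weight w x / ?Z else 0) \<partial>count_space UNIV) =
        (\<Sum>x\<in>ptrees n. ennreal (tree_weight w x / ?Z))"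
      by (subst nn_integral_count_space'[where A = "ptrees n"]) (auto simp: finite_ptrees)
    also have "\<dots> = ennreal (\<Sum>x\<in>ptrees n. tree_weight w x / ?Z)"
      using nonneg Z by (intro sum_ennreal) simp
    also have "(\<Sum>x\<in>ptrees n. tree_weight w x / ?Z) = 1"
      using Z by (simp flip: sum_divide_distrib)
    finally show "(\<integral>\<^sup>+x. ennreal (if x \<in> ptrees n then tree_weight w x / ?Z else 0)
        \<partial>count_space UNIV) = 1" by simp
  qed
qed


section \<open>Uniform integrability\<close>

text \<open>
  The members of the family may live on different probability spaces. The expectations are
  taken in \<open>[0, \<infinity>]\<close>, so integrability of the members is part of the condition.
\<close>

definition uniformly_integrable ::
    "'i set \<Rightarrow> ('i \<Rightarrow> 'a measure) \<Rightarrow> ('i \<Rightarrow> 'a \<Rightarrow> real) \<Rightarrow> bool" where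
  "uniformly_integrable I M X \<longleftrightarrow>
    (\<forall>i\<in>I. X i \<in> borel_measurable (M i)) \<and>
    ((\<lambda>K::real. SUP i\<in>I. \<integral>\<^sup>+x. ennreal \<bar>X i x\<bar> * indicator {y. K < \<bar>X i y\<bar>} x \<partial>M i)
      \<longlongrightarrow> 0) at_top"

end

theory Submission
  imports Defs "HOL-Combinatorics.Multiset_Permutations" "HOL-Real_Asymp.Real_Asymp"
begin

text \<open>
  The border distance is at most the length of the leftmost path, so it suffices to bound the
  probability that this path has length at least \<open>h\<close>. Given the multiset \<open>M\<close> of its \<open>n\<close> outdegrees,
  the random tree is uniform. Removing the root of the first tree shows by induction that \<open>k / n\<close>
  times the number of permutations of \<open>M\<close> is the number of forests of \<open>k\<close> trees with outdegrees \<open>M\<close>.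
  The same recursion, restricted to nonzero root degrees, gives the probability bound
  \<open>4 h b ^ (h - 1)\<close> for \<open>2 h \<le> n\<close> if the proportion of leaves is at least \<open>1 - b\<close>. A small
  proportion of leaves is exponentially unlikely: a tree with few leaves has mostly vertices of
  outdegree 1, and replacing \<open>K\<close> outdegrees 1 by one \<open>K\<close> and \<open>K - 1\<close> zeros (where \<open>K \<ge> 2\<close> and
  \<open>w K > 0\<close>) at least doubles the total weight of the multiset. Hence the border distance has
  uniformly exponential tails, and all its moments are bounded in \<open>n\<close>.
\<close>

section \<open>Outdegree multisets, tree weights and leftmost paths\<close>

primrec degs :: "ptree \<Rightarrow> nat multiset" where
  "degs (Node ts) = add_mset (length ts) (sum_list (map degs ts))"

text \<open>\<^term>\<open>deep h T\<close>: the leftmost path of \<^term>\<open>T\<close> has at least \<^term>\<open>h\<close> edges.\<close>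

primrec deep :: "nat \<Rightarrow> ptree \<Rightarrow> bool" where
  "deep 0 T \<longleftrightarrow> True"
| "deep (Suc h) T \<longleftrightarrow> children T \<noteq> [] \<and> deep h (hd (children T))"

lemma size_sum_list: "size (sum_list (Ms :: 'a multiset list)) = sum_list (map size Ms)"
  by (induction Ms) auto

lemma sum_mset_of_sum_list: "sum_mset (sum_list (Ms :: nat multiset list)) = sum_list (map sum_mset Ms)"
  by (induction Ms) auto

lemma size_degs: "size (degs T) = card (vertices T)"
proof (induction T)
  case (Node ts)
  have "sum_list (map (\<lambda>t. size (degs t)) ts) = sum_list (map (\<lambda>t. card (vertices t)) ts)"
    using Node by (intro arg_cong[of _ _ sum_list] map_cong) auto
  then show ?case
    by (simp add: card_vertices_Node size_sum_list sum_list_sum_nth o_def atLeast0LessThan)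
qed

text \<open>Every vertex except the root is counted exactly once, as a child of its parent.\<close>

lemma sum_degs: "Suc (sum_mset (degs T)) = size (degs T)"
proof (induction T)
  case (Node ts)
  have "sum_list (map (\<lambda>t. size (degs t)) ts) = sum_list (map (\<lambda>t. Suc (sum_mset (degs t))) ts)"
    using Node by (intro arg_cong[of _ _ sum_list] map_cong) auto
  also have "\<dots> = length ts + sum_list (map (\<lambda>t. sum_mset (degs t)) ts)"
    by (induction ts) auto
  finally show ?case
    by (simp add: size_sum_list sum_mset_of_sum_list o_def)
qed

definition mset_weight :: "(nat \<Rightarrow> real) \<Rightarrow> nat multiset \<Rightarrow> real" where
  "mset_weight w M = prod_mset (image_mset w M)"

lemma mset_weight_sum_list: "mset_weight w (sum_list Ms) = prod_list (map (mset_weight w) Ms)"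
  by (induction Ms) (auto simp: mset_weight_def)

lemma outdegree_Cons:
  "i < length ts \<Longrightarrow> outdegree (Node ts) (i # v) = outdegree (ts ! i) v"
  by (simp add: outdegree_def)

lemma tree_weight_Node:
  "tree_weight w (Node ts) = w (length ts) * (\<Prod>i<length ts. tree_weight w (ts ! i))"
proof -
  let ?f = "\<lambda>v. w (outdegree (Node ts) v)"
  have "prod ?f (\<Union>i<length ts. (#) i ` vertices (ts ! i)) =
      (\<Prod>i<length ts. prod ?f ((#) i ` vertices (ts ! i)))"
    by (rule prod.UNION_disjoint) (auto simp: finite_vertices)
  also have "\<dots> = (\<Prod>i<length ts. tree_weight w (ts ! i))"
    by (intro prod.cong refl) (auto simp: prod.reindex tree_weight_def outdegree_Cons)
  finally have "prod ?f (\<Union>i<length ts. (#) i ` vertices (ts ! i)) =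
      (\<Prod>i<length ts. tree_weight w (ts ! i))" .
  then show ?thesis
    unfolding tree_weight_def[of w "Node ts"] vertices_Node
    by (subst prod.insert) (auto simp: finite_vertices outdegree_def)
qed

text \<open>The weight sees only the outdegree multiset, which is why the random tree is uniform
  once this multiset is given.\<close>

lemma tree_weight_degs: "tree_weight w T = mset_weight w (degs T)"
proof (induction T)
  case (Node ts)
  have "(\<Prod>i<length ts. tree_weight w (ts ! i)) = (\<Prod>i<length ts. mset_weight w (degs (ts ! i)))"
    using Node by (intro prod.cong) auto
  also have "\<dots> = prod_list (map (\<lambda>t. mset_weight w (degs t)) ts)"
    by (simp add: prod.list_conv_set_nth atLeast0LessThan)
  also have "\<dots> = mset_weight w (sum_list (map degs ts))"
    by (simp add: mset_weight_sum_list o_def)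
  finally show ?case
    by (simp add: tree_weight_Node) (simp add: mset_weight_def)
qed

text \<open>The prefixes of the address \<open>v\<close> are vertices and form a path from the root
  to \<open>v\<close>.\<close>

lemma graph_dist_root_le:
  assumes "v \<in> vertices T"
  shows "graph_dist T [] v \<le> length v"
proof -
  have prefix: "u \<in> vertices T" if "u @ x \<in> vertices T" for u x
  proof -
    have "subtree_at T (u @ x) \<noteq> None \<Longrightarrow> subtree_at T u \<noteq> None"
      by (induction u arbitrary: T) (auto split: if_splits)
    with that show ?thesis by (simp add: vertices_def)
  qed
  have "([], v) \<in> adjacent T ^^ length v"
    using assms
  proof (induction v rule: rev_induct)
    case (snoc i v)
    then have "v \<in> vertices T" by (blast intro: prefix)
    with snoc show ?case by (auto simp: adjacent_def intro!: relcompI)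
  qed simp
  then show ?thesis unfolding graph_dist_def by (rule Least_le)
qed

text \<open>A leftmost path with fewer than \<open>h\<close> edges ends in a leaf at distance less
  than \<open>h\<close> from the root.\<close>

lemma deep_if_le_border_dist:
  assumes "h \<le> border_dist T"
  shows "deep h T"
proof (rule ccontr)
  assume "\<not> deep h T"
  then have "\<exists>v\<in>leaves T. length v < h"
  proof (induction h arbitrary: T)
    case (Suc h)
    obtain ts where T: "T = Node ts" by (cases T)
    show ?case
    proof (cases ts)
      case Nil
      then show ?thesis by (intro bexI[of _ "[]"]) (auto simp: T leaves_def vertices_def outdegree_def)
    next
      case (Cons t us)
      with Suc.prems T have "\<not> deep h t" by simp
      with Suc.IH obtain v where "v \<in> leaves t" "length v < h" by blast
      then show ?thesis
        by (intro bexI[of _ "0 # v"]) (auto simp: T Cons leaves_def vertices_def outdegree_def)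
    qed
  qed simp
  then obtain v where v: "v \<in> leaves T" "length v < h" by blast
  have "border_dist T \<le> graph_dist T [] v"
    unfolding border_dist_def using v
    by (intro Min_le) (auto simp: leaves_def finite_vertices)
  also have "\<dots> \<le> length v"
    using v by (intro graph_dist_root_le) (auto simp: leaves_def)
  finally show False using v assms by simp
qed

lemma size_eq_count_plus_filter: "size M = count M x + size (filter_mset (\<lambda>y. y \<noteq> x) M)"
  by (induction M) auto

text \<open>The first \<open>h\<close> vertices of the leftmost path have a child, so they are
  counted beside the leaves.\<close>

lemma deep_count_zero:
  assumes "deep h T"
  shows "h + count (degs T) 0 \<le> size (degs T)"
proof -
  have "h \<le> size (filter_mset (\<lambda>d. d \<noteq> 0) (degs T))"
    using assms
  proof (induction h arbitrary: T)
    case (Suc h)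
    then obtain t us where T: "T = Node (t # us)"
      by (cases T) (auto simp: neq_Nil_conv)
    with Suc have "h \<le> size (filter_mset (\<lambda>d. d \<noteq> 0) (degs t))" by simp
    then show ?case by (simp add: T)
  qed simp
  moreover have "size (degs T) = count (degs T) 0 + size (filter_mset (\<lambda>d. d \<noteq> 0) (degs T))"
    by (rule size_eq_count_plus_filter)
  ultimately show ?thesis by simp
qed

section \<open>Counting plane forests with given outdegrees\<close>

definition forests :: "nat multiset \<Rightarrow> nat \<Rightarrow> ptree list set" where
  "forests M k = {ts. length ts = k \<and> sum_list (map degs ts) = M}"

text \<open>Deleting the root of the first tree turns its \<open>d\<close> children into the first \<open>d\<close> trees.\<close>

lemma card_forests_Suc:
  fixes P :: "nat \<Rightarrow> ptree list \<Rightarrow> bool"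
  shows "finite (forests M k)" and
   "card {ts \<in> forests M (Suc k). P (length (children (hd ts))) (children (hd ts) @ tl ts)} =
    (\<Sum>d\<in>set_mset M. card {us \<in> forests (M - {#d#}) (k + d). P d us})"
proof -
  \<comment> \<open>\<open>?g d\<close> undoes the deletion: the first \<open>d\<close> trees become
    the children of a new root. The predicate \<open>P\<close> sees the degree of the deleted root
    and the remaining forest, so one bijection serves both for all forests and for those with a long
    leftmost path.\<close>
  let ?g = "\<lambda>d us. Node (take d us) # drop d us"
  have eq: "{ts \<in> forests M (Suc k). P (length (children (hd ts))) (children (hd ts) @ tl ts)} =
     (\<Union>d\<in>set_mset M. ?g d ` {us \<in> forests (M - {#d#}) (k + d). P d us})" for M k P
  proof (intro equalityI subsetI)
    fix ts
    assume ts: "ts \<in> {ts \<in> forests M (Suc k). P (length (children (hd ts))) (children (hd ts) @ tl ts)}"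
    then obtain us vs where eq: "ts = Node us # vs"
      by (cases ts; cases "hd ts") (auto simp: forests_def)
    have "ts = ?g (length us) (us @ vs)" by (simp add: eq)
    moreover have "us @ vs \<in> forests (M - {#length us#}) (k + length us)" "length us \<in># M" "P (length us) (us @ vs)"
      using ts by (auto simp: eq forests_def)
    ultimately show "ts \<in> (\<Union>d\<in>set_mset M. ?g d ` {us \<in> forests (M - {#d#}) (k + d). P d us})"
      by blast
  next
    fix ts assume "ts \<in> (\<Union>d\<in>set_mset M. ?g d ` {us \<in> forests (M - {#d#}) (k + d). P d us})"
    then obtain d us where d: "d \<in># M" "us \<in> forests (M - {#d#}) (k + d)" "P d us" "ts = ?g d us"
      by auto
    then have "length us = k + d" "sum_list (map degs us) = M - {#d#}" by (auto simp: forests_def)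
    moreover have "sum_list (map degs us) = sum_list (map degs (take d us)) + sum_list (map degs (drop d us))"
      by (metis append_take_drop_id map_append sum_list_append)
    ultimately show "ts \<in> {ts \<in> forests M (Suc k). P (length (children (hd ts))) (children (hd ts) @ tl ts)}"
      using d by (auto simp: forests_def)
  qed
  show fin: "finite (forests M k)" for M k
  proof (induction "size M" arbitrary: M k)
    case 0
    have "forests {#} k \<subseteq> {[]}"
    proof
      fix ts assume ts: "ts \<in> forests {#} k"
      show "ts \<in> {[]}"
      proof (cases ts)
        case (Cons t us)
        with ts show ?thesis by (cases t) (auto simp: forests_def)
      qed simp
    qed
    with 0 show ?case by (auto intro: finite_subset)
  next
    case (Suc n)
    show ?case
    proof (cases k)
      case 0
      then have "forests M k \<subseteq> {[]}" by (auto simp: forests_def)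
      then show ?thesis by (auto intro: finite_subset)
    next
      case k: (Suc k')
      have "finite (\<Union>d\<in>set_mset M. ?g d ` {us \<in> forests (M - {#d#}) (k' + d). True})"
        using Suc by (intro finite_UN_I finite_imageI) (auto simp: size_Diff_singleton)
      then show ?thesis using eq[of M k' "\<lambda>_ _. True"] k by simp
    qed
  qed
  show "card {ts \<in> forests M (Suc k). P (length (children (hd ts))) (children (hd ts) @ tl ts)} =
    (\<Sum>d\<in>set_mset M. card {us \<in> forests (M - {#d#}) (k + d). P d us})"
    unfolding eq
  proof (subst card_UN_disjoint)
    show "\<forall>i\<in>set_mset M. \<forall>j\<in>set_mset M. i \<noteq> j \<longrightarrow>
       ?g i ` {us \<in> forests (M - {#i#}) (k + i). P i us} \<inter> ?g j ` {us \<in> forests (M - {#j#}) (k + j). P j us} = {}"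
    proof (intro ballI impI equals0I)
      fix i j ts
      assume "i \<noteq> j" and "ts \<in> ?g i ` {us \<in> forests (M - {#i#}) (k + i). P i us} \<inter> ?g j ` {us \<in> forests (M - {#j#}) (k + j). P j us}"
      \<comment> \<open>Both lists are long enough for \<open>take\<close> to return
        \<open>i\<close> and \<open>j\<close> trees, so equal first trees would force
        \<open>i = j\<close>.\<close>
      then obtain us vs :: "ptree list" where
        "length us = k + i" "length vs = k + j" "take i us = take j vs"
        by (fastforce simp: forests_def)
      with \<open>i \<noteq> j\<close> show False by (metis add.commute diff_add_inverse le_add1 length_take min.absorb2)
    qed
    show "(\<Sum>d\<in>set_mset M. card (?g d ` {us \<in> forests (M - {#d#}) (k + d). P d us})) =
      (\<Sum>d\<in>set_mset M. card {us \<in> forests (M - {#d#}) (k + d). P d us})"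
    proof (intro sum.cong refl card_image inj_onI)
      fix d us vs assume "?g d us = ?g d vs"
      then show "us = vs" by (metis append_take_drop_id list.inject ptree.inject)
    qed
  qed (use fin in auto)
qed

abbreviation perms :: "nat multiset \<Rightarrow> real" where
  "perms M \<equiv> real (card (permutations_of_multiset M))"

text \<open>By symmetry, the permutations of \<open>M\<close> that begin with \<open>d\<close> are a
  proportion \<open>count M d / size M\<close> of all, and dropping the first entry leaves a
  permutation of \<open>M - {#d#}\<close>.\<close>

lemma perms_remove: "d \<in># M \<Longrightarrow> size M * perms (M - {#d#}) = count M d * perms M"
  using card_permutations_of_multiset_remove_aux[of d M]
  by (metis mult.commute of_nat_mult)

lemma sum_count_weighted:
  "(\<Sum>d\<in>set_mset M. real (count M d) * real d) = real (sum_mset M)"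
proof -
  \<comment> \<open>The index set is enlarged to a fixed \<open>A\<close>, so that it does not
    change when an element is added to \<open>M\<close>.\<close>
  have "(\<Sum>d\<in>A. real (count M d) * real d) = real (sum_mset M)" if "finite A" "set_mset M \<subseteq> A" for A
    using that
  proof (induction M)
    case (add x M)
    have "(\<Sum>d\<in>A. real (count (add_mset x M) d) * real d) =
        (\<Sum>d\<in>A. real (count M d) * real d + (if d = x then real d else 0))"
      by (intro sum.cong) (auto simp: algebra_simps)
    with add show ?case by (simp add: sum.distrib)
  qed simp
  then show ?thesis by simp
qed

lemma sum_count: "(\<Sum>d\<in>set_mset M. real (count M d)) = real (size M)"
  by (simp add: size_multiset_overloaded_eq)

text \<open>This is the forest count usually obtained from the cycle lemma, here by root deletion.
  With \<open>n = size M - 1\<close> and \<open>k = Suc k'\<close>, the induction hypothesis and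
  \<open>perms_remove\<close> turn the term of root degree \<open>d\<close> into
  \<open>(k' + d) * count M d * perms M\<close>. Summed over \<open>d\<close>, this gives
  \<open>k' * size M + sum_mset M = n * k\<close> times \<open>perms M\<close>.\<close>

lemma card_forests:
  assumes "sum_mset M + k = size M"
  shows "size M * real (card (forests M k)) = k * perms M"
  using assms
proof (induction "size M" arbitrary: M k)
  case 0
  then show ?case by simp
next
  case (Suc n)
  show ?case
  proof (cases k)
    case 0
    have "forests M 0 = {}" using Suc.hyps(2) by (auto simp: forests_def)
    then show ?thesis using 0 by simp
  next
    case k: (Suc k')
    have rec: "real (card (forests M k)) = (\<Sum>d\<in>set_mset M. real (card (forests (M - {#d#}) (k' + d))))"
      using card_forests_Suc(2)[of M k' "\<lambda>_ _. True"] by (simp add: k)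
    have IH: "n * real (card (forests (M - {#d#}) (k' + d))) = (k' + d) * perms (M - {#d#})"
      if d: "d \<in># M" for d
    proof -
      have "sum_mset (M - {#d#}) + (k' + d) = n"
        using d Suc.prems Suc.hyps(2) k by (simp add: sum_mset.remove)
      moreover have "size (M - {#d#}) = n" using d Suc.hyps(2) by (simp add: size_Diff_singleton)
      ultimately show ?thesis using Suc.hyps(1)[of "M - {#d#}" "k' + d"] by simp
    qed
    show ?thesis
    \<comment> \<open>The general argument cancels a factor \<open>n\<close>, so the forest with a
      single vertex is treated apart.\<close>
    proof (cases "n = 0")
      case True
      with Suc.hyps(2) obtain d where "M = {#d#}" by (metis One_nat_def size_1_singleton_mset)
      moreover from this have "d = 0" "k' = 0" using Suc.prems k by auto
      moreover have "forests {#} 0 = {[]}" by (auto simp: forests_def)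
      ultimately show ?thesis using rec k by simp
    next
      case False
      have "n * (size M * real (card (forests M k))) =
          (\<Sum>d\<in>set_mset M. size M * (n * real (card (forests (M - {#d#}) (k' + d)))))"
        unfolding rec by (simp add: sum_distrib_left mult_ac)
      also have "\<dots> = (\<Sum>d\<in>set_mset M. (k' + d) * (count M d * perms M))"
        by (intro sum.cong refl) (simp add: IH flip: perms_remove)
      also have "\<dots> = perms M * (k' * (\<Sum>d\<in>set_mset M. real (count M d)) +
          (\<Sum>d\<in>set_mset M. real (count M d) * real d))"
        by (simp add: sum_distrib_left sum.distrib algebra_simps)
      also have "\<dots> = perms M * (k' * size M + sum_mset M)"
        by (simp only: sum_count_weighted sum_count of_nat_add of_nat_mult)
      also have "k' * size M + sum_mset M = n * k"
      proof -
        have "sum_mset M + k' = n" using Suc.prems k Suc.hyps(2) by simp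
        then show ?thesis unfolding k by (simp add: algebra_simps flip: Suc.hyps(2))
      qed
      finally show ?thesis using False by simp
    qed
  qed
qed

section \<open>Forests whose first tree has a long leftmost path\<close>

text \<open>Only the first tree is restricted, because deleting its root puts its leftmost subtree
  in first place.\<close>

definition deep_forests :: "nat \<Rightarrow> nat multiset \<Rightarrow> nat \<Rightarrow> ptree list set" where
  "deep_forests h M k = {ts \<in> forests M k. deep h (hd ts)}"

text \<open>A leftmost path with an edge excludes root degree 0. For any other root degree the first
  child heads the new forest and has to carry one edge less.\<close>

lemma card_deep_forests_Suc:
  "card (deep_forests (Suc h) M (Suc k)) =
    (\<Sum>d\<in>set_mset M - {0}. card (deep_forests h (M - {#d#}) (k + d)))"
proof -
  let ?P = "\<lambda>d us. d \<noteq> 0 \<and> deep h (hd us)"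
  have "deep_forests (Suc h) M (Suc k) =
      {ts \<in> forests M (Suc k). ?P (length (children (hd ts))) (children (hd ts) @ tl ts)}"
    by (auto simp: deep_forests_def)
  then have "card (deep_forests (Suc h) M (Suc k)) =
      (\<Sum>d\<in>set_mset M. card {us \<in> forests (M - {#d#}) (k + d). ?P d us})"
    using card_forests_Suc(2)[of M k ?P] by presburger
  also have "\<dots> = (\<Sum>d\<in>set_mset M - {0}. card {us \<in> forests (M - {#d#}) (k + d). ?P d us})"
    by (rule sum.mono_neutral_right) auto
  also have "\<dots> = (\<Sum>d\<in>set_mset M - {0}. card (deep_forests h (M - {#d#}) (k + d)))"
    by (intro sum.cong refl arg_cong[of _ _ card]) (auto simp: deep_forests_def)
  finally show ?thesis .
qed

lemma sum_count_nonzero: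
  "(\<Sum>d\<in>set_mset M - {0}. real (count M d)) = real (size M) - count M 0"
  "(\<Sum>d\<in>set_mset M - {0}. real (count M d) * real d) = sum_mset M"
proof -
  show "(\<Sum>d\<in>set_mset M - {0}. real (count M d)) = real (size M) - count M 0"
    by (cases "0 \<in># M") (simp_all add: sum_diff1 sum_count not_in_iff)
  show "(\<Sum>d\<in>set_mset M - {0}. real (count M d) * real d) = sum_mset M"
    by (cases "0 \<in># M") (simp_all add: sum_diff1 sum_count_weighted)
qed

text \<open>Write \<open>n\<close> for \<open>size M\<close> and \<open>m\<close> for
  \<open>count M 0\<close>. The right side is affine in \<open>k\<close>, and the recursion keeps it
  affine because only the number and the sum of the nonzero outdegrees enter. The case
  \<open>h = 0\<close> is an equality. Each further root deletion contributes a factor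
  \<open>(n - m - 1) / n\<close>, which is at most \<open>b\<close>. The factors on the left are the
  denominators that remain.\<close>

lemma card_deep_forests_le:
  fixes b :: real
  assumes "sum_mset M + k = size M" "1 \<le> k" "Suc h < size M" "Suc h + count M 0 \<le> size M"
    and "size M - count M 0 \<le> b * size M" "b \<le> 1"
  shows "(real (size M) - Suc h) * (real (size M) - h) * card (deep_forests (Suc h) M k) \<le>
    perms M * b ^ h * (k * (real (size M) - count M 0 - Suc h) + Suc h * real (count M 0))"
  using assms
proof (induction h arbitrary: M k)
  case 0
  define n m where "n = size M" "m = count M 0"
  obtain k' where k: "k = Suc k'" using 0 by (cases k) auto
  have sum_M: "real (sum_mset M) = real n - k"
    unfolding n_m_def(1) using 0(1) by (metis add_diff_cancel_right' of_nat_add)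
  have F: "(real n - 1) * card (deep_forests 0 (M - {#d#}) (k' + d)) = (k' + d) * perms (M - {#d#})"
    if d: "d \<in># M" for d
  proof -
    have "sum_mset (M - {#d#}) + (k' + d) = n - 1"
      using d 0 k by (simp add: sum_mset.remove n_m_def)
    moreover have "size (M - {#d#}) = n - 1" using d by (simp add: size_Diff_singleton n_m_def)
    ultimately show ?thesis using card_forests[of "M - {#d#}" "k' + d"] 0
      by (simp add: deep_forests_def n_m_def of_nat_diff)
  qed
  have "(real n - 1) * n * card (deep_forests (Suc 0) M k) =
      (\<Sum>d\<in>set_mset M - {0}. n * ((real n - 1) * card (deep_forests 0 (M - {#d#}) (k' + d))))"
    unfolding k card_deep_forests_Suc by (simp add: sum_distrib_left mult_ac)
  also have "\<dots> = (\<Sum>d\<in>set_mset M - {0}. (k' + d) * (count M d * perms M))"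
    by (intro sum.cong refl) (simp add: F[unfolded n_m_def] n_m_def flip: perms_remove)
  also have "\<dots> = perms M * (k' * (\<Sum>d\<in>set_mset M - {0}. real (count M d)) +
      (\<Sum>d\<in>set_mset M - {0}. real (count M d) * real d))"
    by (simp add: sum_distrib_left sum.distrib algebra_simps)
  also have "\<dots> = perms M * (k' * (real n - m) + (real n - k))"
    by (simp only: sum_count_nonzero sum_M flip: n_m_def)
  also have "k' * (real n - m) + (real n - k) = k * (real n - m - 1) + m"
    by (simp add: k algebra_simps)
  finally show ?case by (simp add: n_m_def)
next
  case (Suc h)
  define n m where "n = size M" "m = count M 0"
  obtain k' where k: "k = Suc k'" using Suc by (cases k) auto
  have sum_M: "real (sum_mset M) = real n - k"
    unfolding n_m_def(1) using Suc.prems(1) by (metis add_diff_cancel_right' of_nat_add)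
  have b: "0 \<le> b"
  proof (rule ccontr)
    assume "\<not> 0 \<le> b"
    then have "b * size M < 0" using Suc.prems(3) by (simp add: mult_neg_pos)
    then show False using Suc.prems(5) by linarith
  qed
  let ?r = "(real n - Suc (Suc h)) * (real n - Suc h)"
  have F: "?r * card (deep_forests (Suc h) (M - {#d#}) (k' + d)) \<le>
      perms (M - {#d#}) * b ^ h * ((k' + d) * (real n - m - Suc (Suc h)) + Suc h * real m)"
    if d: "d \<in># M" "d \<noteq> 0" for d
  proof -
    have s: "size (M - {#d#}) = n - 1" "real (n - 1) = real n - 1" "count (M - {#d#}) 0 = m"
      using d Suc.prems by (auto simp: size_Diff_singleton n_m_def)
    have 1: "sum_mset (M - {#d#}) + (k' + d) = size (M - {#d#})"
      unfolding s using d Suc.prems k by (simp add: sum_mset.remove n_m_def)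
    \<comment> \<open>Removing a vertex that is not a leaf lowers the left side by 1 and the right
      side by \<open>b \<le> 1\<close>.\<close>
    have 2: "real (n - 1 - m) \<le> b * real (n - 1)"
    proof -
      have "real (n - 1 - m) = real (n - m) - 1"
        using Suc.prems by (simp add: n_m_def)
      also have "\<dots> \<le> b * n - 1" using Suc.prems by (simp add: n_m_def)
      also have "\<dots> \<le> b * (real n - 1)" using \<open>b \<le> 1\<close> by (simp add: algebra_simps)
      finally show ?thesis using s by simp
    qed
    show ?thesis
      using Suc.IH[of "M - {#d#}" "k' + d", OF 1] 2 d Suc.prems
      unfolding s by (simp add: n_m_def algebra_simps)
  qed
  have nonneg: "0 \<le> k * (real n - m - Suc (Suc h)) + Suc (Suc h) * real m"
    using Suc.prems by (intro add_nonneg_nonneg mult_nonneg_nonneg) (auto simp: n_m_def)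
  have affine: "(\<Sum>d\<in>A. real (c d) * p * q * ((k' + d) * e + g)) =
      p * q * ((k' * e + g) * (\<Sum>d\<in>A. real (c d)) + e * (\<Sum>d\<in>A. real (c d) * real d))"
    for A c and p q e g :: real
  proof -
    have "(\<Sum>d\<in>A. real (c d) * p * q * ((k' + d) * e + g)) =
        (\<Sum>d\<in>A. p * q * (k' * e + g) * real (c d) + p * q * e * (real (c d) * real d))"
      by (intro sum.cong refl) (simp add: algebra_simps)
    then show ?thesis by (simp add: sum.distrib algebra_simps flip: sum_distrib_left)
  qed
  have "n * (?r * card (deep_forests (Suc (Suc h)) M k)) =
      (\<Sum>d\<in>set_mset M - {0}. n * (?r * card (deep_forests (Suc h) (M - {#d#}) (k' + d))))"
    unfolding k card_deep_forests_Suc[of "Suc h"] by (simp add: sum_distrib_left mult_ac)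
  also have "\<dots> \<le> (\<Sum>d\<in>set_mset M - {0}. n * (perms (M - {#d#}) * b ^ h *
      ((k' + d) * (real n - m - Suc (Suc h)) + Suc h * real m)))"
    by (intro sum_mono mult_left_mono F) auto
  also have "\<dots> = (\<Sum>d\<in>set_mset M - {0}. count M d * perms M * b ^ h *
      ((k' + d) * (real n - m - Suc (Suc h)) + Suc h * real m))"
    by (intro sum.cong refl) (simp add: n_m_def flip: perms_remove)
  also have "\<dots> = perms M * b ^ h * ((k' * (real n - m - Suc (Suc h)) + Suc h * real m) *
      (\<Sum>d\<in>set_mset M - {0}. real (count M d)) + (real n - m - Suc (Suc h)) *
      (\<Sum>d\<in>set_mset M - {0}. real (count M d) * real d))"
    by (rule affine)
  also have "\<dots> = perms M * b ^ h * ((k' * (real n - m - Suc (Suc h)) + Suc h * real m) *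
      (real n - m) + (real n - m - Suc (Suc h)) * (real n - k))"
    by (simp only: sum_count_nonzero sum_M flip: n_m_def)
  \<comment> \<open>This identity dictates the coefficients of the bound: the affine form in
    \<open>k\<close> returns with \<open>Suc h\<close> advanced by one, times
    \<open>n - m - 1\<close>. That factor is then traded for \<open>b * n\<close>.\<close>
  also have "(k' * (real n - m - Suc (Suc h)) + Suc h * real m) *
      (real n - m) + (real n - m - Suc (Suc h)) * (real n - k) =
      (real n - m - 1) * (k * (real n - m - Suc (Suc h)) + Suc (Suc h) * real m)"
    by (simp add: k algebra_simps)
  also have "perms M * b ^ h * ((real n - m - 1) * (k * (real n - m - Suc (Suc h)) + Suc (Suc h) * real m)) \<le>
      perms M * b ^ h * ((b * n) * (k * (real n - m - Suc (Suc h)) + Suc (Suc h) * real m))"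
    using Suc.prems b nonneg
    by (intro mult_left_mono mult_right_mono) (auto simp: n_m_def of_nat_diff)
  finally have "n * (?r * card (deep_forests (Suc (Suc h)) M k)) \<le>
     n * (perms M * b ^ Suc h * (k * (real n - m - Suc (Suc h)) + Suc (Suc h) * real m))"
    by (simp add: mult_ac)
  moreover have "0 < n" using Suc.prems by (simp add: n_m_def)
  ultimately have "?r * card (deep_forests (Suc (Suc h)) M k) \<le>
     perms M * b ^ Suc h * (k * (real n - m - Suc (Suc h)) + Suc (Suc h) * real m)"
    by simp
  then show ?case by (simp add: n_m_def)
qed

lemma card_degs_deep_eq: "card {T. degs T = M \<and> deep h T} = card (deep_forests h M 1)"
proof -
  have "deep_forests h M 1 = (\<lambda>T. [T]) ` {T. degs T = M \<and> deep h T}"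
    by (auto simp: deep_forests_def forests_def length_Suc_conv)
  then show ?thesis by (simp add: card_image inj_on_def)
qed

lemma card_degs_eq:
  assumes "size M = Suc (sum_mset M)"
  shows "size M * real (card {T. degs T = M}) = perms M"
  using card_forests[of M 1] card_degs_deep_eq[of M 0] assms by (simp add: deep_forests_def)

text \<open>This is \<open>card_deep_forests_le\<close> for \<open>k = 1\<close>. Since
  \<open>2 * h \<le> size M\<close>, both factors on its left are at least half of
  \<open>size M\<close>, whence the 4, and the affine term is at most
  \<open>h * size M\<close>.\<close>

lemma card_deep_le:
  fixes b :: real
  assumes "size M = Suc (sum_mset M)" "1 \<le> h" "2 * h \<le> size M"
    and b: "real (size M) - count M 0 \<le> b * size M" "b \<le> 1"
  shows "size M * real (card {T. degs T = M \<and> deep h T}) \<le> 4 * h * b ^ (h - 1) * perms M"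
proof -
  have "real (count M 0) \<le> real (size M)" using count_le_size by simp
  then have "0 \<le> b * size M" using b(1) by linarith
  moreover have "0 < size M" unfolding assms(1) by simp
  ultimately have b0: "0 \<le> b" by (auto simp: zero_le_mult_iff)
  show ?thesis
  proof (cases "h + count M 0 \<le> size M")
    case False
    then have "{T. degs T = M \<and> deep h T} = {}" using deep_count_zero by blast
    then have "card {T. degs T = M \<and> deep h T} = 0" by (simp only: card.empty)
    then show ?thesis using b0 by simp
  next
    case True
    define n m where "n = size M" "m = count M 0"
    obtain h' where h: "h = Suc h'" using assms by (cases h) auto
    define Q where "Q = real (card {T. degs T = M \<and> deep h T})"
    have le: "(real n - h) * (real n - h') * Q \<le> perms M * b ^ h' * ((real n - m - h) + h * real m)"
    proof -
      have "Q = real (card (deep_forests (Suc h') M 1))" by (simp only: Q_def card_degs_deep_eq h)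
      then show ?thesis using card_deep_forests_le[of M 1 h' b] assms True
        by (simp add: h n_m_def of_nat_diff)
    qed
    have hn: "2 * h \<le> n" using assms(3) by (simp add: n_m_def)
    have "(real n / 2) * (real n / 2) * Q \<le> (real n - h) * (real n - h') * Q"
      using hn by (intro mult_right_mono mult_mono) (auto simp: Q_def h)
    also note le
    also have "perms M * b ^ h' * ((real n - m - h) + h * real m) \<le> perms M * b ^ h' * (h * n)"
    proof (intro mult_left_mono)
      have "h' * real m \<le> h' * real n" by (intro mult_left_mono) (auto simp: n_m_def count_le_size)
      then show "(real n - m - h) + h * real m \<le> real (h * n)" by (simp add: h algebra_simps)
    qed (use b0 in auto)
    finally have "n * (n * Q) \<le> n * (4 * h * b ^ h' * perms M)" by (simp add: algebra_simps)
    moreover have "0 < n" using assms by (auto simp: n_m_def)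
    ultimately show ?thesis by (simp add: n_m_def Q_def h)
  qed
qed

section \<open>Outdegree multisets with few leaves have small total weight\<close>

text \<open>By \<open>sum_degs\<close> and \<open>card_degs_eq\<close>, these are exactly the
  outdegree multisets of trees with \<open>n\<close> vertices.\<close>

definition degree_multisets :: "nat \<Rightarrow> nat multiset set" where
  "degree_multisets n = {M. size M = n \<and> Suc (sum_mset M) = n}"

lemma finite_degree_multisets: "finite (degree_multisets n)"
proof (rule finite_subset)
  show "degree_multisets n \<subseteq> mset ` {xs. set xs \<subseteq> {..n} \<and> length xs = n}"
  proof
    fix M assume M: "M \<in> degree_multisets n"
    obtain xs where xs: "M = mset xs" by (metis ex_mset)
    have "x \<le> n" if "x \<in># M" for x
    proof -
      have "sum_mset M = x + sum_mset (M - {#x#})" using that by (rule sum_mset.remove)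
      then show ?thesis using M by (simp add: degree_multisets_def)
    qed
    then show "M \<in> mset ` {xs. set xs \<subseteq> {..n} \<and> length xs = n}"
      using M xs by (auto simp: degree_multisets_def)
  qed
qed (auto intro: finite_lists_length_eq)

text \<open>If \<open>M\<close> has size \<open>n\<close> and sum \<open>n - 1\<close>, this is \<open>n\<close> times the total weight of the trees with
  outdegrees \<open>M\<close>.\<close>

definition perm_weight :: "(nat \<Rightarrow> real) \<Rightarrow> nat multiset \<Rightarrow> real" where
  "perm_weight w M = mset_weight w M * perms M"

lemma mset_weight_nonneg: "(\<And>k. 0 \<le> w k) \<Longrightarrow> 0 \<le> mset_weight w M"
  unfolding mset_weight_def by (induction M) auto

lemma perm_weight_nonneg: "(\<And>k. 0 \<le> w k) \<Longrightarrow> 0 \<le> perm_weight w M"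
  unfolding perm_weight_def by (simp add: mset_weight_nonneg)

lemma perms_add:
  "perms (add_mset x M) * (real (count M x) + 1) = (real (size M) + 1) * perms M"
  using arg_cong[OF card_permutations_of_multiset_insert_aux[of M x], of real] by (simp add: algebra_simps)

text \<open>Each insertion of \<open>x\<close> multiplies the number of permutations by the new size
  over the new multiplicity of \<open>x\<close>; over \<open>j\<close> insertions these form two
  rising factorials.\<close>

lemma perms_add_replicate:
  "perms (M + replicate_mset j x) * pochhammer (real (count M x) + 1) j =
    perms M * pochhammer (real (size M) + 1) j"
proof (induction j)
  case (Suc j)
  have "perms (M + replicate_mset (Suc j) x) * pochhammer (real (count M x) + 1) (Suc j) =
      perms (add_mset x (M + replicate_mset j x)) * (real (count (M + replicate_mset j x) x) + 1) *
        pochhammer (real (count M x) + 1) j"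
    by (simp add: pochhammer_Suc algebra_simps)
  also have "\<dots> = (real (size M + j) + 1) * (perms (M + replicate_mset j x) * pochhammer (real (count M x) + 1) j)"
    by (simp only: perms_add) (simp add: algebra_simps)
  also have "\<dots> = perms M * pochhammer (real (size M) + 1) (Suc j)"
    by (simp only: Suc.IH) (simp add: pochhammer_Suc algebra_simps)
  finally show ?case .
qed simp

lemma pochhammer_bounds:
  fixes a :: real
  assumes "0 \<le> a"
  shows "a ^ j \<le> pochhammer a j" "pochhammer a j \<le> (a + j) ^ j"
proof -
  have "(\<Prod>i = 0..<j. a) \<le> pochhammer a j" "pochhammer a j \<le> (\<Prod>i = 0..<j. a + j)"
    unfolding pochhammer_prod using assms by (intro prod_mono; auto)+
  then show "a ^ j \<le> pochhammer a j" "pochhammer a j \<le> (a + j) ^ j" by simp_all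
qed

text \<open>With few leaves nearly all outdegrees are 1. Exchanging \<open>K\<close> ones for one
  \<open>K\<close> and \<open>K - 1\<close> zeros then gains a factor of at least
  \<open>(L - 2) ^ K\<close> in permutations, and \<open>wL\<close> says that this makes up twice
  over for the change in the vertex weights.\<close>

lemma perm_weight_double:
  fixes w :: "nat \<Rightarrow> real" and L :: nat
  assumes w: "\<And>k. 0 \<le> w k" and K: "2 \<le> K" and L: "3 \<le> L"
    and wL: "2 * w 1 ^ K \<le> (real L - 2) ^ K * (w K * w 0 ^ (K - 1))"
    and M: "size M = Suc (sum_mset M)" and small: "L * (count M 0 + K) \<le> size M"
  shows "replicate_mset K 1 \<subseteq># M"
    and "2 * perm_weight w M \<le>
      perm_weight w (M - replicate_mset K 1 + add_mset K (replicate_mset (K - 1) 0))"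
proof -
  define m where "m = count M 0"
  define r where "r = size (filter_mset (\<lambda>d. 2 \<le> d) M)"
  \<comment> \<open>The sum of the outdegrees is less than their number, so vertices of outdegree at
    least 2 are outnumbered by leaves.\<close>
  have "count M 1 + 2 * r \<le> sum_mset M" unfolding r_def by (induction M) auto
  moreover have sz: "size M = m + count M 1 + r" unfolding r_def m_def by (induction M) auto
  ultimately have r: "Suc r \<le> m" using M by simp
  have "count M K = count (filter_mset (\<lambda>d. 2 \<le> d) M) K" using K by simp
  also have "\<dots> \<le> r" unfolding r_def by (rule count_le_size)
  finally have cK: "count M K \<le> r" .
  obtain l where l: "L = l + 2" using L that[of "L - 2"] by simp
  then have "l * (m + K) + 2 * (m + K) \<le> size M"
    using small by (simp add: m_def algebra_simps)
  then have "l * (m + K) + K \<le> count M 1" using sz r unfolding distrib_left by linarith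
  then have c1: "(L - 2) * (m + K) + K \<le> count M 1" by (simp add: l)
  then show sub: "replicate_mset K 1 \<subseteq># M"
    by (simp flip: count_le_replicate_mset_subset_eq)
  \<comment> \<open>\<open>R\<close> is the part common to the old and the new multiset; their
    permutation numbers are compared by building both from \<open>R\<close>.\<close>
  define R where "R = M - replicate_mset K 1"
  have MR: "M = R + replicate_mset K 1" unfolding R_def using sub by simp
  define M' where "M' = R + add_mset K (replicate_mset (K - 1) 0)"
  have cR: "count R 0 = m" "count R K = count M K" "count R 1 = count M 1 - K"
    using K by (auto simp: R_def m_def)
  have "perms M * pochhammer (real (count R 1) + 1) K = perms R * pochhammer (real (size R) + 1) K"
    unfolding MR by (rule perms_add_replicate)
  also have "\<dots> = (perms R * (real (size R) + 1)) * pochhammer (real (size (add_mset K R)) + 1) (K - 1)"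
    using K by (cases K) (simp_all add: pochhammer_rec add_ac)
  also have "perms R * (real (size R) + 1) = perms (add_mset K R) * (real (count M K) + 1)"
    using perms_add[of K R] cR by (simp add: mult.commute)
  also have "perms (add_mset K R) * (real (count M K) + 1) * pochhammer (real (size (add_mset K R)) + 1) (K - 1) =
      perms M' * (pochhammer (real m + 1) (K - 1) * (real (count M K) + 1))"
    using perms_add_replicate[of "add_mset K R" "K - 1" 0] K cR
    by (simp add: M'_def mult_ac)
  finally have eq: "perms M * pochhammer (real (count R 1) + 1) K =
      perms M' * (pochhammer (real m + 1) (K - 1) * (real (count M K) + 1))" .
  have "((real L - 2) * (m + K)) ^ K \<le> (real (count R 1) + 1) ^ K"
  proof (rule power_mono)
    have "(L - 2) * (m + K) \<le> count R 1" using c1 cR by simp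
    then have "real ((L - 2) * (m + K)) \<le> real (count R 1)" by (simp only: of_nat_le_iff)
    then show "(real L - 2) * (m + K) \<le> real (count R 1) + 1" using L by (simp add: of_nat_diff)
  qed (use L in auto)
  also have "\<dots> \<le> pochhammer (real (count R 1) + 1) K"
    by (intro pochhammer_bounds) auto
  finally have "perms M * ((real L - 2) * (m + K)) ^ K \<le>
      perms M' * (pochhammer (real m + 1) (K - 1) * (real (count M K) + 1))"
    unfolding eq[symmetric] by (intro mult_left_mono) auto
  \<comment> \<open>Of the \<open>K\<close> factors, \<open>K - 1\<close> come from the inserted
    zeros and one from the inserted \<open>K\<close>; each is at most \<open>m + K\<close>.\<close>
  also have "\<dots> \<le> perms M' * (real (m + K) ^ (K - 1) * real (m + K))"
  proof (intro mult_left_mono mult_mono)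
    have "pochhammer (real m + 1) (K - 1) \<le> (real m + 1 + real (K - 1)) ^ (K - 1)"
      by (intro pochhammer_bounds) auto
    then show "pochhammer (real m + 1) (K - 1) \<le> real (m + K) ^ (K - 1)" using K by (simp add: of_nat_diff)
  qed (use cK r in auto)
  also have "real (m + K) ^ (K - 1) * real (m + K) = real (m + K) ^ K"
    using K by (cases K) simp_all
  finally have "real (m + K) ^ K * (perms M * (real L - 2) ^ K) \<le> real (m + K) ^ K * perms M'"
    by (simp add: power_mult_distrib mult_ac)
  moreover have "0 < real (m + K) ^ K" using K by (intro zero_less_power) auto
  ultimately have le: "perms M * (real L - 2) ^ K \<le> perms M'" by (simp only: mult_le_cancel_left_pos)
  have "2 * perm_weight w M = mset_weight w R * (2 * w 1 ^ K) * perms M"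
    by (simp add: perm_weight_def MR mset_weight_def)
  also have "\<dots> \<le> mset_weight w R * ((real L - 2) ^ K * (w K * w 0 ^ (K - 1))) * perms M"
    by (intro mult_right_mono mult_left_mono wL) (auto simp: mset_weight_nonneg w)
  also have "\<dots> = mset_weight w R * (w K * w 0 ^ (K - 1)) * (perms M * (real L - 2) ^ K)"
    by (simp add: mult_ac)
  also have "\<dots> \<le> mset_weight w R * (w K * w 0 ^ (K - 1)) * perms M'"
    by (intro mult_left_mono le mult_nonneg_nonneg) (auto simp: mset_weight_nonneg w)
  also have "\<dots> = perm_weight w M'"
    by (simp add: perm_weight_def M'_def mset_weight_def mult_ac)
  finally show "2 * perm_weight w M \<le>
      perm_weight w (M - replicate_mset K 1 + add_mset K (replicate_mset (K - 1) 0))"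
    by (simp add: M'_def R_def)
qed

text \<open>The exchange in \<open>perm_weight_double\<close> is injective and adds fewer than
  \<open>K\<close> leaves, so allowing \<open>K\<close> more leaves at least doubles the total
  weight. Starting from \<open>n div c\<close> leaves, this can be repeated \<open>n div c\<close>
  times.\<close>

lemma few_leaves:
  assumes "weight_sequence w"
  obtains c :: nat where "2 \<le> c" and "\<And>n. 2 ^ (n div c) *
      (\<Sum>M | M \<in> degree_multisets n \<and> count M 0 \<le> n div c. perm_weight w M) \<le>
      (\<Sum>M\<in>degree_multisets n. perm_weight w M)"
proof -
  have w: "\<And>k. 0 \<le> w k" "0 < w 0" using assms by (auto simp: weight_sequence_def)
  obtain K where K: "2 \<le> K" "0 < w K" using assms by (auto simp: weight_sequence_def)
  define q where "q = w K * w 0 ^ (K - 1)"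
  have q: "0 < q" using w K by (simp add: q_def)
  obtain L0 :: nat where L0: "2 * w 1 ^ K / q \<le> real L0" by (meson real_arch_simple)
  \<comment> \<open>Adding 3 gives \<open>3 \<le> L\<close> and also \<open>1 \<le> L - 2\<close>,
    so that \<open>L - 2\<close> is at most its \<open>K\<close>-th power.\<close>
  define L where "L = L0 + 3"
  have wL: "2 * w 1 ^ K \<le> (real L - 2) ^ K * q"
  proof -
    have "2 * w 1 ^ K / q \<le> real L - 2" using L0 by (simp add: L_def)
    also have "\<dots> \<le> (real L - 2) ^ K" using K by (intro self_le_power) (auto simp: L_def)
    finally show ?thesis using q by (simp add: field_simps)
  qed
  define V where "V n x = (\<Sum>M | M \<in> degree_multisets n \<and> count M 0 \<le> x. perm_weight w M)" for n x
  have step: "2 * V n x \<le> V n (x + K)" if n: "L * (x + K) \<le> n" for n x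
  proof -
    let ?A = "{M. M \<in> degree_multisets n \<and> count M 0 \<le> x}"
    let ?f = "\<lambda>M. M - replicate_mset K 1 + add_mset K (replicate_mset (K - 1) 0)"
    have *: "replicate_mset K 1 \<subseteq># M" "2 * perm_weight w M \<le> perm_weight w (?f M)" if "M \<in> ?A" for M
    proof -
      have "L * (count M 0 + K) \<le> L * (x + K)" using that by simp
      also note n
      finally have "L * (count M 0 + K) \<le> size M" using that by (simp add: degree_multisets_def)
      then show "replicate_mset K 1 \<subseteq># M" "2 * perm_weight w M \<le> perm_weight w (?f M)"
        using perm_weight_double[of w K L M] w K wL that
        by (auto simp: degree_multisets_def L_def q_def)
    qed
    have inj: "inj_on ?f ?A"
    proof (rule inj_onI)
      fix M N assume MN: "M \<in> ?A" "N \<in> ?A" "?f M = ?f N"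
      then have "M - replicate_mset K 1 = N - replicate_mset K 1" by (simp only: add_right_cancel)
      then show "M = N" using *(1)[OF MN(1)] *(1)[OF MN(2)] by (metis subset_mset.diff_add)
    qed
    \<comment> \<open>Size and sum are preserved, and exactly \<open>K - 1\<close> zeros are
      gained.\<close>
    have sub: "?f ` ?A \<subseteq> {M. M \<in> degree_multisets n \<and> count M 0 \<le> x + K}"
    proof
      fix N assume "N \<in> ?f ` ?A"
      then obtain M where M: "M \<in> ?A" "N = ?f M" by auto
      obtain R where R: "M = R + replicate_mset K 1"
        using *(1)[OF M(1)] by (metis subset_mset.diff_add)
      show "N \<in> {M. M \<in> degree_multisets n \<and> count M 0 \<le> x + K}"
        using M K by (auto simp: R degree_multisets_def)
    qed
    have "2 * V n x = (\<Sum>M\<in>?A. 2 * perm_weight w M)" by (simp add: V_def sum_distrib_left)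
    also have "\<dots> \<le> (\<Sum>M\<in>?A. perm_weight w (?f M))" by (intro sum_mono *)
    also have "\<dots> = sum (perm_weight w) (?f ` ?A)" using inj by (simp add: sum.reindex)
    also have "\<dots> \<le> V n (x + K)" unfolding V_def
      by (intro sum_mono2 sub finite_subset[OF _ finite_degree_multisets[of n]] perm_weight_nonneg w) auto
    finally show ?thesis .
  qed
  have iter: "2 ^ j * V n x \<le> V n (x + j * K)" if "L * (x + j * K) \<le> n" for j n x
    using that
  proof (induction j)
    case (Suc j)
    have "L * (x + j * K) \<le> L * (x + Suc j * K)" by (intro mult_left_mono) auto
    then have "2 ^ j * V n x \<le> V n (x + j * K)"
      using Suc.IH Suc.prems order_trans by blast
    then have "2 * (2 ^ j * V n x) \<le> 2 * V n (x + j * K)" by simp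
    also have "\<dots> \<le> V n (x + j * K + K)" using Suc.prems by (intro step) (simp add: algebra_simps)
    finally show ?case by (simp add: algebra_simps)
  qed simp
  \<comment> \<open>With \<open>j = n div c\<close> this choice gives
    \<open>L * (j * K + j * K) \<le> n\<close>, the condition for \<open>j\<close> doublings that
    start from \<open>j * K\<close> leaves.\<close>
  define c where "c = 2 * K * L"
  have V_mono: "V n x \<le> V n y" if "x \<le> y" for n x y
    unfolding V_def using that
    by (intro sum_mono2 finite_subset[OF _ finite_degree_multisets[of n]] perm_weight_nonneg w) auto
  have V_le: "V n x \<le> (\<Sum>M\<in>degree_multisets n. perm_weight w M)" for n x
    unfolding V_def
    by (intro sum_mono2 finite_degree_multisets perm_weight_nonneg w) auto
  have "2 ^ (n div c) * V n (n div c) \<le> (\<Sum>M\<in>degree_multisets n. perm_weight w M)" for n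
  proof -
    let ?j = "n div c"
    have "2 ^ ?j * V n ?j \<le> 2 ^ ?j * V n (?j * K)" using K by (intro mult_left_mono V_mono) auto
    also have "\<dots> \<le> V n (?j * K + ?j * K)"
    proof (rule iter)
      have "L * (?j * K + ?j * K) = c * ?j" by (simp add: c_def algebra_simps)
      then show "L * (?j * K + ?j * K) \<le> n" by simp
    qed
    also note V_le
    finally show ?thesis .
  qed
  moreover have "2 \<le> c" using K by (simp add: c_def L_def)
  ultimately show ?thesis using that unfolding V_def by blast
qed

section \<open>Exponential tail of the border distance\<close>

text \<open>Trees are grouped by outdegree multiset, on which their weight depends. The factor
  \<open>n\<close> matches the form of the counts in \<open>card_degs_eq\<close> and
  \<open>card_deep_le\<close>.\<close>

lemma sum_tree_weight:
  assumes "1 \<le> n"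
  shows "n * (\<Sum>T | T \<in> ptrees n \<and> P T. tree_weight w T) =
    (\<Sum>M\<in>degree_multisets n. mset_weight w M * (n * real (card {T. degs T = M \<and> P T})))"
proof -
  have "(\<Sum>T | T \<in> ptrees n \<and> P T. tree_weight w T) =
      (\<Sum>M\<in>degree_multisets n. \<Sum>T | T \<in> {T. T \<in> ptrees n \<and> P T} \<and> degs T = M. tree_weight w T)"
  proof (rule sum.group[symmetric])
    show "degs ` {T. T \<in> ptrees n \<and> P T} \<subseteq> degree_multisets n"
      using sum_degs by (auto simp: degree_multisets_def ptrees_def size_degs)
  qed (auto simp: finite_ptrees finite_degree_multisets)
  also have "\<dots> = (\<Sum>M\<in>degree_multisets n. mset_weight w M * real (card {T. degs T = M \<and> P T}))"
  proof (intro sum.cong refl)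
    fix M assume M: "M \<in> degree_multisets n"
    have "{T. T \<in> {T. T \<in> ptrees n \<and> P T} \<and> degs T = M} = {T. degs T = M \<and> P T}"
      using M by (auto simp: degree_multisets_def ptrees_def size_degs[symmetric])
    then have "(\<Sum>T | T \<in> {T. T \<in> ptrees n \<and> P T} \<and> degs T = M. tree_weight w T) =
        (\<Sum>T | degs T = M \<and> P T. mset_weight w M)"
      by (intro sum.cong) (auto simp: tree_weight_degs)
    then show "(\<Sum>T | T \<in> {T. T \<in> ptrees n \<and> P T} \<and> degs T = M. tree_weight w T) =
        mset_weight w M * real (card {T. degs T = M \<and> P T})" by (simp add: mult.commute)
  qed
  finally show ?thesis by (simp add: sum_distrib_left mult_ac)
qed

text \<open>The first summand bounds the probability of at most \<open>n div c\<close> leaves, by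
  \<open>few_leaves\<close>. The second bounds, by \<open>card_deep_le\<close>, the probability of a
  long leftmost path when there are more leaves.\<close>

lemma prob_border_dist:
  assumes "weight_sequence w"
  obtains c :: nat where "2 \<le> c" and "\<And>n h. 1 \<le> n \<Longrightarrow> sg_defined w n \<Longrightarrow>
    measure_pmf.prob (sg_tree w n) {T. h \<le> border_dist T} \<le>
      (1 / 2) ^ (h div c) + 4 * real h * (1 - 1 / real c) ^ (h div 2 - 1)"
proof -
  obtain c where c: "2 \<le> c" "\<And>n. 2 ^ (n div c) *
      (\<Sum>M | M \<in> degree_multisets n \<and> count M 0 \<le> n div c. perm_weight w M) \<le>
      (\<Sum>M\<in>degree_multisets n. perm_weight w M)"
    using few_leaves[OF assms] by blast
  have w: "\<And>k. 0 \<le> w k" using assms by (auto simp: weight_sequence_def)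
  define b where "b = 1 - 1 / real c"
  have b: "0 \<le> b" "b \<le> 1" using c(1) by (simp_all add: b_def)
  have "measure_pmf.prob (sg_tree w n) {T. h \<le> border_dist T} \<le>
      (1 / 2) ^ (h div c) + 4 * real h * b ^ (h div 2 - 1)"
    if n: "1 \<le> n" and sg: "sg_defined w n" for n h
  proof (cases "2 \<le> h")
    case False
    \<comment> \<open>For \<open>h < 2\<close> the claimed bound is at least 1.\<close>
    then have "h div c = 0" using c(1) by simp
    moreover have "0 \<le> 4 * real h * b ^ (h div 2 - 1)" using b by simp
    ultimately show ?thesis
      using measure_pmf.prob_le_1[of "sg_tree w n" "{T. h \<le> border_dist T}"]
      unfolding \<open>h div c = 0\<close> power_0 by linarith
  next
    case h: True
    define Z where "Z = (\<Sum>T\<in>ptrees n. tree_weight w T)"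
    \<comment> \<open>A leftmost path with \<open>h\<close> edges forces \<open>h \<le> n\<close>.
      Counting only paths of length \<open>h div 2\<close> then meets the condition
      \<open>2 * (h div 2) \<le> n\<close> of \<open>card_deep_le\<close>.\<close>
    define A where "A = {T. T \<in> ptrees n \<and> deep (h div 2) T \<and> deep h T}"
    obtain S where S: "S \<in> ptrees n" "0 < tree_weight w S"
      using sg by (auto simp: sg_defined_def)
    have Z: "0 < Z" unfolding Z_def
      using S by (intro sum_pos2[of _ S]) (auto simp: finite_ptrees tree_weight_degs mset_weight_nonneg w)
    have "measure_pmf.prob (sg_tree w n) {T. h \<le> border_dist T} \<le>
        measure_pmf.prob (sg_tree w n) (A \<union> - ptrees n)"
    proof (rule measure_pmf.finite_measure_mono)
      have "deep (h div 2) T" "deep h T" if "h \<le> border_dist T" for T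
        using that by (auto intro: deep_if_le_border_dist)
      then show "{T. h \<le> border_dist T} \<subseteq> A \<union> - ptrees n" by (auto simp: A_def)
    qed simp
    also have "\<dots> = measure_pmf.prob (sg_tree w n) A"
      by (intro measure_prob_cong_0) (auto simp: pmf_sg_tree[OF assms sg])
    also have "\<dots> = (\<Sum>T\<in>A. tree_weight w T) / Z"
      using finite_ptrees[of n]
      by (subst measure_measure_pmf_finite)
        (auto simp: A_def pmf_sg_tree[OF assms sg] Z_def sum_divide_distrib intro!: sum.cong)
    also have "\<dots> \<le> (1 / 2) ^ (h div c) + 4 * real h * b ^ (h div 2 - 1)"
    proof (cases "h \<le> n")
      case False
      have "\<not> deep h T" if "T \<in> ptrees n" for T
        using deep_count_zero[of h T] that False by (auto simp: ptrees_def size_degs)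
      then have "A = {}" by (auto simp: A_def)
      then show ?thesis using b by simp
    next
      case True
      let ?D = "degree_multisets n" and ?h = "h div 2"
      let ?F = "{M. M \<in> degree_multisets n \<and> count M 0 \<le> n div c}"
      define r where "r = 4 * real ?h * b ^ (?h - 1)"
      have r: "0 \<le> r" using b by (simp add: r_def)
      have size: "size M = Suc (sum_mset M)" "size M = n" if "M \<in> ?D" for M
        using that by (auto simp: degree_multisets_def)
      have perms_eq: "n * real (card {T. degs T = M}) = perms M" if "M \<in> ?D" for M
        using card_degs_eq[OF size(1)[OF that]] by (simp only: size(2)[OF that])
      have "n * Z = (\<Sum>M\<in>?D. mset_weight w M * (n * real (card {T. degs T = M})))"
        using sum_tree_weight[OF n, of w "\<lambda>_. True"] by (simp add: Z_def)
      also have "\<dots> = (\<Sum>M\<in>?D. perm_weight w M)"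
        by (intro sum.cong refl) (simp only: perms_eq perm_weight_def)
      finally have nZ: "n * Z = (\<Sum>M\<in>?D. perm_weight w M)" .
      have fin: "finite {T. degs T = M \<and> P T}" for M P
        by (rule finite_subset[OF _ finite_ptrees[of "size M"]]) (auto simp: ptrees_def size_degs)
      have fin': "finite {T. degs T = M}" for M using fin[of M "\<lambda>_. True"] by simp
      \<comment> \<open>A multiset with few leaves is charged its whole weight, any other only the
        fraction \<open>r\<close>.\<close>
      have bound: "mset_weight w M * (n * real (card {T. degs T = M \<and> deep ?h T})) \<le>
          (if count M 0 \<le> n div c then perm_weight w M else 0) + r * perm_weight w M"
        if M: "M \<in> ?D" for M
      proof (cases "count M 0 \<le> n div c")
        case True
        have "n * real (card {T. degs T = M \<and> deep ?h T}) \<le> n * real (card {T. degs T = M})"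
          using fin' by (intro mult_left_mono) (auto intro!: card_mono)
        also note perms_eq[OF M]
        finally have "mset_weight w M * (n * real (card {T. degs T = M \<and> deep ?h T})) \<le> perm_weight w M"
          unfolding perm_weight_def by (intro mult_left_mono mset_weight_nonneg w)
        moreover have "0 \<le> r * perm_weight w M" using r by (simp add: perm_weight_nonneg w)
        ultimately show ?thesis using True by simp
      next
        case False
        \<comment> \<open>More than \<open>n div c\<close> leaves are at least \<open>n / c\<close>
          leaves, so a proportion of at most \<open>b\<close> of the vertices are not
          leaves.\<close>
        have "real n / c \<le> count M 0"
        proof -
          have "n mod c < c" using c(1) by simp
          then have "n \<le> c * Suc (n div c)"
            using mult_div_mod_eq[of c n] unfolding mult_Suc_right by linarith
          also have "\<dots> \<le> c * count M 0" using False by (intro mult_left_mono) auto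
          finally have "real n \<le> real c * real (count M 0)" by (metis of_nat_le_iff of_nat_mult)
          then show ?thesis using c(1) by (simp add: field_simps)
        qed
        then have "real (size M) - count M 0 \<le> b * size M"
          unfolding size(2)[OF M] by (simp add: b_def algebra_simps)
        then have "n * real (card {T. degs T = M \<and> deep ?h T}) \<le> r * perms M"
          using card_deep_le[of M ?h b] size[OF M] h True b by (simp add: r_def)
        then have "mset_weight w M * (n * real (card {T. degs T = M \<and> deep ?h T})) \<le>
            mset_weight w M * (r * perms M)"
          by (intro mult_left_mono mset_weight_nonneg w)
        then show ?thesis using False by (simp add: perm_weight_def mult_ac)
      qed
      have "n * (\<Sum>T\<in>A. tree_weight w T) \<le> n * (\<Sum>T | T \<in> ptrees n \<and> deep ?h T. tree_weight w T)"
        by (intro mult_left_mono sum_mono2)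
          (auto simp: A_def finite_ptrees tree_weight_degs mset_weight_nonneg w)
      also have "\<dots> = (\<Sum>M\<in>?D. mset_weight w M * (n * real (card {T. degs T = M \<and> deep ?h T})))"
        by (rule sum_tree_weight[OF n])
      also have "\<dots> \<le> (\<Sum>M\<in>?D. (if count M 0 \<le> n div c then perm_weight w M else 0) + r * perm_weight w M)"
        by (intro sum_mono bound)
      also have "\<dots> = (\<Sum>M\<in>?F. perm_weight w M) + r * (\<Sum>M\<in>?D. perm_weight w M)"
        by (simp add: sum.distrib sum_distrib_left sum.inter_filter finite_degree_multisets)
      also have "(\<Sum>M\<in>?F. perm_weight w M) \<le> (1 / 2) ^ (n div c) * (n * Z)"
        using c(2)[of n] unfolding nZ[symmetric] by (simp add: field_simps)
      finally have "n * (\<Sum>T\<in>A. tree_weight w T) \<le> n * (((1 / 2) ^ (n div c) + r) * Z)"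
        by (simp add: nZ[symmetric] algebra_simps)
      then have "(\<Sum>T\<in>A. tree_weight w T) / Z \<le> (1 / 2) ^ (n div c) + r"
        using n Z by (simp only: mult_le_cancel_left_pos pos_divide_le_eq of_nat_0_less_iff
            less_eq_Suc_le One_nat_def)
      \<comment> \<open>Here \<open>h \<le> n\<close> makes the bound independent of
        \<open>n\<close>.\<close>
      also have "(1 / 2 :: real) ^ (n div c) \<le> (1 / 2) ^ (h div c)"
        using True by (intro power_decreasing div_le_mono) auto
      also have "r \<le> 4 * real h * b ^ (h div 2 - 1)"
        unfolding r_def using b by (intro mult_right_mono) auto
      finally show ?thesis by simp
    qed
    finally show ?thesis .
  qed
  with c(1) that show ?thesis unfolding b_def by blast
qed

section \<open>Bounded moments and uniform integrability\<close>

text \<open>Rounding down in \<open>h div c\<close> costs at most a factor \<open>1 / b\<close>, so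
  the power is at most \<open>exp (- s * h) / b\<close> with \<open>s = - ln b / c > 0\<close>; this
  decay beats any power of \<open>h\<close>.\<close>

lemma summable_powr_mult_power_div:
  fixes a b :: real and c :: nat
  assumes "0 < b" "b < 1" "1 \<le> c"
  shows "summable (\<lambda>h. real h powr a * b ^ (h div c))"
proof -
  define s where "s = - ln b / c"
  have s: "0 < s" using assms by (simp add: s_def divide_neg_pos)
  have "(\<lambda>h::nat. real h powr a * exp (- s * real h)) \<in> O(\<lambda>h. 1 / real h ^ 2)"
    using s by real_asymp
  moreover have "summable (\<lambda>h::nat. norm (1 / real h ^ 2))"
    using inverse_power_summable[of 2, where 'a = real] by (simp add: divide_inverse)
  ultimately have "summable (\<lambda>h::nat. real h powr a * exp (- s * real h))"
    by (rule summable_comparison_test_bigo[rotated])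
  then have "summable (\<lambda>h. (real h powr a * exp (- s * real h)) * (1 / b))"
    by (rule summable_mult2)
  then show ?thesis
  proof (rule summable_comparison_test'[where N = 0])
    fix h :: nat
    have "b ^ (h div c) = exp (real (h div c) * ln b)"
      using assms by (simp add: exp_of_nat_mult)
    also have "real (h div c) * ln b \<le> (real h / c - 1) * ln b"
    proof (rule mult_right_mono_neg)
      have "h mod c < c" using assms by simp
      then have "h \<le> c * (h div c) + c" using mult_div_mod_eq[of c h] by linarith
      then have "real h \<le> real c * real (h div c) + real c" by (metis of_nat_add of_nat_le_iff of_nat_mult)
      then show "real h / c - 1 \<le> real (h div c)" using assms by (simp add: field_simps)
    qed (use assms in auto)
    also have "(real h / c - 1) * ln b = - s * real h - ln b"
      by (simp add: s_def algebra_simps)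
    also have "exp \<dots> = exp (- s * real h) * (1 / b)"
      using assms by (simp add: exp_diff)
    finally have "b ^ (h div c) \<le> exp (- s * real h) * (1 / b)" by simp
    then have "real h powr a * b ^ (h div c) \<le> real h powr a * (exp (- s * real h) * (1 / b))"
      by (rule mult_left_mono) simp
    then show "norm (real h powr a * b ^ (h div c)) \<le> (real h powr a * exp (- s * real h)) * (1 / b)"
      using assms by (simp add: mult.assoc)
  qed
qed

text \<open>The power \<open>X powr a\<close> is at most the sum of \<open>h powr a\<close> over all
  \<open>h \<le> X\<close>. Taking expectations, the tail bound of \<open>prob_border_dist\<close>
  yields a convergent series that does not depend on \<open>n\<close>.\<close>

lemma border_dist_moments_bounded:
  fixes a :: real
  assumes "weight_sequence w"
  obtains C :: real where "0 \<le> C" and "\<And>n. 1 \<le> n \<Longrightarrow> sg_defined w n \<Longrightarrow>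
    (\<integral>\<^sup>+T. ennreal (real (border_dist T) powr a) \<partial>measure_pmf (sg_tree w n)) \<le> ennreal C"
proof -
  obtain c :: nat where c: "2 \<le> c" and prob: "\<And>n h. 1 \<le> n \<Longrightarrow> sg_defined w n \<Longrightarrow>
    measure_pmf.prob (sg_tree w n) {T. h \<le> border_dist T} \<le>
      (1 / 2) ^ (h div c) + 4 * real h * (1 - 1 / real c) ^ (h div 2 - 1)"
    using prob_border_dist[OF assms] by blast
  define b where "b = 1 - 1 / real c"
  have b: "0 < b" "b < 1" using c by (simp_all add: b_def)
  define g where "g h = (1 / 2) ^ (h div c) + 4 * real h * b ^ (h div 2 - 1)" for h
  have g: "0 \<le> g h" for h using b by (simp add: g_def)
  define f where "f h = real h powr a * g h" for h :: nat
  have f: "0 \<le> f h" for h by (simp add: f_def g)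
  have "summable (\<lambda>h. real h powr a * (1 / 2) ^ (h div c) +
      4 / b * (real h powr (a + 1) * b ^ (h div 2)))"
    using b c by (intro summable_add summable_mult summable_powr_mult_power_div) auto
  then have "summable f"
  proof (rule summable_comparison_test'[where N = 0])
    fix h :: nat
    \<comment> \<open>If \<open>h div 2 = 0\<close>, the truncated exponent is 0 and the claim reads
      \<open>1 \<le> 1 / b\<close>; otherwise equality holds.\<close>
    have "b ^ (h div 2 - 1) \<le> b ^ (h div 2) / b"
      using b by (cases "h div 2") (auto simp: divide_simps)
    then have "real h powr a * (4 * real h * b ^ (h div 2 - 1)) \<le> real h powr a * (4 * real h * (b ^ (h div 2) / b))"
      by (intro mult_left_mono) auto
    also have "\<dots> = 4 / b * (real h powr (a + 1) * b ^ (h div 2))"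
      by (cases "h = 0") (simp_all add: powr_add)
    finally show "norm (f h) \<le> real h powr a * (1 / 2) ^ (h div c) +
      4 / b * (real h powr (a + 1) * b ^ (h div 2))"
      using f[of h] by (simp add: f_def g_def distrib_left)
  qed
  have "(\<integral>\<^sup>+T. ennreal (real (border_dist T) powr a) \<partial>measure_pmf (sg_tree w n)) \<le> ennreal (suminf f)"
    if n: "1 \<le> n" "sg_defined w n" for n
  proof -
    let ?M = "measure_pmf (sg_tree w n)"
    let ?u = "\<lambda>h T. ennreal (real h powr a) * indicator {T. h \<le> border_dist T} T"
    have "(\<integral>\<^sup>+T. ennreal (real (border_dist T) powr a) \<partial>?M) \<le> (\<integral>\<^sup>+T. (\<Sum>h. ?u h T) \<partial>?M)"
    proof (rule nn_integral_mono)
      fix T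
      \<comment> \<open>The single term \<open>h = border_dist T\<close> already equals the
        integrand.\<close>
      have "(\<Sum>h\<in>{border_dist T}. ?u h T) \<le> (\<Sum>h. ?u h T)" by (intro sum_le_suminf) auto
      then show "ennreal (real (border_dist T) powr a) \<le> (\<Sum>h. ?u h T)" by simp
    qed
    also have "\<dots> = (\<Sum>h. \<integral>\<^sup>+T. ?u h T \<partial>?M)" by (rule nn_integral_suminf) simp
    also have "\<dots> \<le> (\<Sum>h. ennreal (f h))"
    proof (intro suminf_le)
      fix h
      have "(\<integral>\<^sup>+T. ?u h T \<partial>?M) = ennreal (real h powr a) * emeasure ?M {T. h \<le> border_dist T}"
        by (rule nn_integral_cmult_indicator) simp
      also have "\<dots> \<le> ennreal (real h powr a) * ennreal (g h)"
        using prob[OF n, of h] unfolding measure_pmf.emeasure_eq_measure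
        by (intro mult_left_mono ennreal_leI) (auto simp: g_def b_def)
      also have "\<dots> = ennreal (f h)" by (simp add: f_def ennreal_mult' g)
      finally show "(\<integral>\<^sup>+T. ?u h T \<partial>?M) \<le> ennreal (f h)" .
    qed auto
    also have "\<dots> = ennreal (suminf f)" using f \<open>summable f\<close> by (rule suminf_ennreal2)
    finally show ?thesis .
  qed
  moreover have "0 \<le> suminf f" using \<open>summable f\<close> f by (rule suminf_nonneg)
  ultimately show ?thesis using that by blast
qed

text \<open>Where the \<open>p\<close>-th power exceeds \<open>K\<close>, it is at most the power of
  order \<open>2 * p\<close> divided by \<open>K\<close>. With \<open>C\<close> a bound on the
  moments of order \<open>2 * p\<close>, uniform in \<open>n\<close>, all tail expectations are at
  most \<open>C / K\<close>.\<close>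

theorem lemma4p13:
  fixes w :: "nat \<Rightarrow> real" and p :: real
  assumes "weight_sequence w"
    and "type_I w \<or> type_II w \<or> type_III w"
    and "0 \<le> p"
  shows "uniformly_integrable {n. 1 \<le> n \<and> sg_defined w n}
    (\<lambda>n. measure_pmf (sg_tree w n)) (\<lambda>n T. real (border_dist T) powr p)"
proof -
  let ?I = "{n. 1 \<le> n \<and> sg_defined w n}"
  let ?X = "\<lambda>T. real (border_dist T) powr p"
  let ?tail = "\<lambda>K::real. SUP n\<in>?I. \<integral>\<^sup>+T. ennreal \<bar>?X T\<bar> * indicator {S. K < \<bar>?X S\<bar>} T \<partial>measure_pmf (sg_tree w n)"
  obtain C where C: "0 \<le> C" "\<And>n. 1 \<le> n \<Longrightarrow> sg_defined w n \<Longrightarrow>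
    (\<integral>\<^sup>+T. ennreal (real (border_dist T) powr (2 * p)) \<partial>measure_pmf (sg_tree w n)) \<le> ennreal C"
    using border_dist_moments_bounded[OF assms(1), of "2 * p"] by blast
  have tail: "?tail K \<le> ennreal (C / K)" if K: "0 < K" for K
  proof (rule SUP_least)
    fix n assume n: "n \<in> ?I"
    have "(\<integral>\<^sup>+T. ennreal \<bar>?X T\<bar> * indicator {S. K < \<bar>?X S\<bar>} T \<partial>measure_pmf (sg_tree w n)) \<le>
        (\<integral>\<^sup>+T. ennreal (1 / K) * ennreal (real (border_dist T) powr (2 * p)) \<partial>measure_pmf (sg_tree w n))"
    proof (rule nn_integral_mono)
      fix T
      have sq: "?X T * ?X T = real (border_dist T) powr (2 * p)"
        by (simp flip: powr_add)
      have "?X T * K \<le> ?X T * ?X T" if "K < ?X T" using that by (intro mult_left_mono) auto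
      then have "?X T \<le> 1 / K * real (border_dist T) powr (2 * p)" if "K < ?X T"
        using that K by (simp add: sq field_simps)
      then show "ennreal \<bar>?X T\<bar> * indicator {S. K < \<bar>?X S\<bar>} T \<le>
          ennreal (1 / K) * ennreal (real (border_dist T) powr (2 * p))"
        using K by (auto simp: indicator_def ennreal_mult'[symmetric] intro!: ennreal_leI)
    qed
    also have "\<dots> = ennreal (1 / K) *
        (\<integral>\<^sup>+T. ennreal (real (border_dist T) powr (2 * p)) \<partial>measure_pmf (sg_tree w n))"
      by (rule nn_integral_cmult) simp
    also have "\<dots> \<le> ennreal (1 / K) * ennreal C" using C(2) n by (intro mult_left_mono) auto
    also have "\<dots> = ennreal (C / K)" using K C(1) by (simp add: ennreal_mult'[symmetric])
    finally show "(\<integral>\<^sup>+T. ennreal \<bar>?X T\<bar> * indicator {S. K < \<bar>?X S\<bar>} T \<partial>measure_pmf (sg_tree w n)) \<le> ennreal (C / K)" .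
  qed
  have "((\<lambda>K. ennreal (C / K)) \<longlongrightarrow> ennreal 0) at_top"
    by (intro tendsto_ennrealI tendsto_divide_0[OF tendsto_const] filterlim_at_top_imp_at_infinity filterlim_ident)
  then have "((\<lambda>K. ennreal (C / K)) \<longlongrightarrow> 0) at_top" by simp
  moreover have "eventually (\<lambda>K. ?tail K \<le> ennreal (C / K)) at_top"
    using eventually_gt_at_top[of 0] by (rule eventually_mono) (rule tail)
  ultimately have "(?tail \<longlongrightarrow> 0) at_top"
    by (intro tendsto_sandwich[OF _ _ tendsto_const, of _ ?tail]) auto
  then show ?thesis unfolding uniformly_integrable_def by simp
qed

end
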